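(* Assume: (a) $\mathcal S\subset\mathbb R^m$ and $\mathcal A\subset\mathbb R^n$ are convex and compact; (b) for each $\xi\in\Xi$, $\mathcal C(s,a,\xi)$ is convex and continuous in $(s,a)\in\mathcal S\times\mathcal A$; (c) $g(s,a,\xi)=A(\xi)s+B(\xi)a+b(\xi)$ with $A:\Xi\to\mathbb R^{m\times m}$, $B:\Xi\to\mathbb R^{m\times n}$, $b:\Xi\to\mathbb R^m$ measurable. Fix an episode $N$ and let $\{\bar s_k\}$ and $\{\underline V_N^k\}$ be the sequences of trial states and value-function approximations generated by the Bellman-operator cutting-plane (BOCP) algorithm (run without termination). Assume that for every $s\in\mathcal S$, $\varepsilon>0$ and $K\in\mathbb N$ there exists an index $k\ge K$ such that $\|\bar s_k-s\|<\varepsilon$ almost surely. If the pointwise limit $\underline V_N^\infty=\lim_{k\to\infty}\underline V_N^k$ is continuous on $\mathcal S$, then $\{\underline V_N^k\}$ converges to $\hat V_N^*$, that is, as $k\to\infty$, $\underline V_N^k(s)\uparrow\hat V_N^*(s)$ for all $s\in\mathcal S$, and $\|\underline V_N^k-\hat V_N^*\|_\infty\to0$.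
   Context: Model: $\mathcal S,\mathcal A$ are nonempty; $\Xi=\{\xi^1,\dots,\xi^J\}\subseteq\mathbb R^k$ is finite; $\mathscr P(\Xi)$ is identified with the probability vectors $(p_j)_{j=1}^J$, $p_j=P(\xi=\xi^j)$. $\mathcal C:\mathcal S\times\mathcal A\times\Xi\to\mathbb R$, $g:\mathcal S\times\mathcal A\times\Xi\to\mathcal S$, $\gamma\in[0,1)$, $\bar{\mathcal C}=\sup_{s,a,\xi}|\mathcal C(s,a,\xi)|<\infty$; $\mathcal C^j(s,a)=\mathcal C(s,a,\xi^j)$, $A^j=A(\xi^j)$, $B^j=B(\xi^j)$, $b^j=b(\xi^j)$. Ambiguity set of episode $N$: with $\tau_{j,0}>1$, data $\hat\xi_1,\dots,\hat\xi_N\in\Xi$, $\tau_{j,N}=\tau_{j,0}+\sum_{i=1}^N\mathbf 1_{\{\hat\xi_i=\xi^j\}}$, $\alpha\in(0,1)$, $\alpha'=\alpha/J$, $z_{1-\alpha'/2}$ the standard normal $(1-\alpha'/2)$-quantile: $\hat p_{j,N}=\frac{\tau_{j,N}-1}{\sum_k\tau_{k,N}-J}$, $\hat r_{j,N}=z_{1-\alpha'/2}\sqrt{\frac{\hat p_{j,N}(1-\hat p_{j,N})}{\sum_k\tau_{k,N}-J}}$, $\mathfrak P(\hat P_N,\hat r_N)=\{P\in\mathscr P(\Xi):\hat p_{j,N}-\hat r_{j,N}\le p_j\le\hat p_{j,N}+\hat r_{j,N}\ \forall j\}$. Put $\hat p^l_{j,N}=\max\{0,\hat p_{j,N}-\hat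 r_{j,N}\}$, $\hat p^u_{j,N}=\min\{1,\hat p_{j,N}+\hat r_{j,N}\}$, $\mathbf L=\sum_j\hat p^l_{j,N}\in(0,1)$, $\mathbf U=\sum_j\hat p^u_{j,N}>1$, $p^l_{j,N}=\hat p^l_{j,N}/\mathbf L$, $p^{u-l}_{j,N}=(\hat p^u_{j,N}-\hat p^l_{j,N})/(\mathbf U-\mathbf L)$, $\lambda_N=\mathbf L$, $\upsilon_N=(\mathbf U-1)/(\mathbf U-\mathbf L)$. Bellman operator on bounded functions $V:\mathcal S\to\mathbb R$: $\hat{\mathcal L}_N(V)(s)=\inf_{a\in\mathcal A}\sup_{P\in\mathfrak P(\hat P_N,\hat r_N)}\mathbb E_P[\mathcal C(s,a,\xi)+\gamma V(g(s,a,\xi))]$; it equals $\inf_{a\in\mathcal A,\zeta\in\mathbb R}\big\{\lambda_N\sum_jp^l_{j,N}h_j+(1-\lambda_N)\zeta+\frac{1-\lambda_N}{1-\upsilon_N}\sum_jp^{u-l}_{j,N}[h_j-\zeta]^+\big\}$ with $h_j=\mathcal C^j(s,a)+\gamma V(A^js+B^ja+b^j)$. $\hat V_N^*$ is its unique bounded fixed point; $\|\cdot\|_\infty$ is the sup-norm on $\mathcal S$. BOCP algorithm (fixed $N$): start with $\bar s_0\in\mathcal S$ and $\underline V_N^0\equiv-\bar{\mathcal C}/(1-\gamma)$. At iteration $k=0,1,2,\dots$: (1) Let $(\bar a_k,\bar\zeta_k,\bar y)$ minimize, over $a\in\mathcal A$, $\zeta\in\mathbb R$, $y\in\mathbb R_+^J$,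 the function $\lambda_N\sum_jp^l_{j,N}[\mathcal C^j(\bar s_k,a)+\gamma\underline V_N^k(A^j\bar s_k+B^ja+b^j)]+(1-\lambda_N)\zeta+\frac{1-\lambda_N}{1-\upsilon_N}\sum_jp^{u-l}_{j,N}y_j$ subject to $y_j\ge\mathcal C^j(\bar s_k,a)+\gamma\underline V_N^k(A^j\bar s_k+B^ja+b^j)-\zeta$ for all $j$. (2) Let $\mathfrak a_j^\star\ge0$ be optimal (KKT) multipliers of the latter constraints (and $\mathfrak b_j^\star\ge0$ those of $y_j\ge0$), and $\theta_j=\frac{(1-\upsilon_N)\mathfrak a_j^\star}{(1-\lambda_N)p^{u-l}_{j,N}}$. (3) With $s_j'=A^j\bar s_k+B^j\bar a_k+b^j$, set $\underline v_k=\lambda_N\sum_jp^l_{j,N}[\mathcal C^j(\bar s_k,\bar a_k)+\gamma\underline V_N^k(s_j')]+(1-\lambda_N)\bar\zeta_k+\frac{1-\lambda_N}{1-\upsilon_N}\sum_jp^{u-l}_{j,N}[\mathcal C^j(\bar s_k,\bar a_k)+\gamma\underline V_N^k(s_j')-\bar\zeta_k]^+$ (which equals $\hat{\mathcal L}_N(\underline V_N^k)(\bar s_k)$), and choose an operator-level subgradient $q_k\in\sum_j\big(\lambda_Np^l_{j,N}+\frac{1-\lambda_N}{1-\upsilon_N}p^{u-l}_{j,N}\theta_j\big)\big[\partial_s\mathcal C^j(\bar s_k,\bar a_k)+\gamma(A^j)^\top\partial\underline V_N^k(s_j')\big]$ (convex subdifferentials, $\partial_s$ being the block in $s$) such that the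 cut $\ell_{k+1}(s)=\underline v_k+q_k^\top(s-\bar s_k)$ is supporting, i.e. $\ell_{k+1}\le\hat{\mathcal L}_N(\underline V_N^k)$ on $\mathcal S$. (4) $\underline V_N^{k+1}=\max\{\underline V_N^k,\ell_{k+1}\}$; draw $\xi^j\in\Xi$ at random and set $\bar s_{k+1}=A^j\bar s_k+B^j\bar a_k+b^j$. The sequence $\{\underline V_N^k\}$ is nondecreasing and bounded above by $\hat V_N^*$, so $\underline V_N^\infty$ exists. Statements about the random sequence are understood almost surely. *)

theory Defs
  imports "HOL-Probability.Probability"
begin

text \<open>The finite set $\Xi$ is the range of \<open>scenario\<close>, whose index type \<open>'j\<close> plays the role of
  $\{1, \dots, J\}$. The functions in the record are total, but only their values for states,
  actions and scenarios in the respective sets are relevant.\<close>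

record ('m, 'n, 'k, 'j) dro_problem =
  states :: "(real ^ 'm) set"
  actions :: "(real ^ 'n) set"
  scenario :: "'j \<Rightarrow> real ^ 'k"
  cost :: "real ^ 'm \<Rightarrow> real ^ 'n \<Rightarrow> real ^ 'k \<Rightarrow> real"
  dynamics :: "real ^ 'm \<Rightarrow> real ^ 'n \<Rightarrow> real ^ 'k \<Rightarrow> real ^ 'm"
  matA :: "real ^ 'k \<Rightarrow> real ^ 'm ^ 'm"
  matB :: "real ^ 'k \<Rightarrow> real ^ 'n ^ 'm"
  vecb :: "real ^ 'k \<Rightarrow> real ^ 'm"
  discount :: real
  prior :: "'j \<Rightarrow> real"        \<comment> \<open>$\tau_{j,0}$\<close>
  level :: real                \<comment> \<open>$\alpha$\<close>
  obs :: "nat \<Rightarrow> real ^ 'k"    \<comment> \<open>$\hat\xi_1, \hat\xi_2, \dots$; the value at 0 is unused\<close>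

abbreviation scenarios :: "('m::finite, 'n::finite, 'k::finite, 'j::finite) dro_problem \<Rightarrow> (real ^ 'k) set"
  where "scenarios M \<equiv> range (scenario M)"

definition cost_bound :: "('m::finite, 'n::finite, 'k::finite, 'j::finite) dro_problem \<Rightarrow> real" where
  "cost_bound M = (SUP (s, a, \<xi>) \<in> states M \<times> actions M \<times> scenarios M. \<bar>cost M s a \<xi>\<bar>)"

definition std_normal_quantile :: "real \<Rightarrow> real" where
  "std_normal_quantile q = Inf {z. q \<le> cdf std_normal_distribution z}"

definition posterior :: "('m::finite, 'n::finite, 'k::finite, 'j::finite) dro_problem \<Rightarrow> nat \<Rightarrow> 'j \<Rightarrow> real" where
  "posterior M N j = prior M j + (\<Sum>i = 1..N. if obs M i = scenario M j then 1 else 0)"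

definition posterior_size :: "('m::finite, 'n::finite, 'k::finite, 'j::finite) dro_problem \<Rightarrow> nat \<Rightarrow> real" where
  "posterior_size M N = (\<Sum>j\<in>UNIV. posterior M N j) - real CARD('j)"

definition p_hat :: "('m::finite, 'n::finite, 'k::finite, 'j::finite) dro_problem \<Rightarrow> nat \<Rightarrow> 'j \<Rightarrow> real" where
  "p_hat M N j = (posterior M N j - 1) / posterior_size M N"

definition r_hat :: "('m::finite, 'n::finite, 'k::finite, 'j::finite) dro_problem \<Rightarrow> nat \<Rightarrow> 'j \<Rightarrow> real" where
  "r_hat M N j =
     (let \<alpha>' = level M / real CARD('j)
      in std_normal_quantile (1 - \<alpha>' / 2) * sqrt (p_hat M N j * (1 - p_hat M N j) / posterior_size M N))"

definition prob_vectors :: "(real ^ 'j::finite) set" where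
  "prob_vectors = {p. (\<forall>j. 0 \<le> p $ j) \<and> (\<Sum>j\<in>UNIV. p $ j) = 1}"

definition ambiguity_set ::
  "('m::finite, 'n::finite, 'k::finite, 'j::finite) dro_problem \<Rightarrow> nat \<Rightarrow> (real ^ 'j) set" where
  "ambiguity_set M N =
     {p \<in> prob_vectors. \<forall>j. p_hat M N j - r_hat M N j \<le> p $ j \<and> p $ j \<le> p_hat M N j + r_hat M N j}"

definition p_lower :: "('m::finite, 'n::finite, 'k::finite, 'j::finite) dro_problem \<Rightarrow> nat \<Rightarrow> 'j \<Rightarrow> real" where
  "p_lower M N j = max 0 (p_hat M N j - r_hat M N j)"

definition p_upper :: "('m::finite, 'n::finite, 'k::finite, 'j::finite) dro_problem \<Rightarrow> nat \<Rightarrow> 'j \<Rightarrow> real" where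
  "p_upper M N j = min 1 (p_hat M N j + r_hat M N j)"

definition lower_mass :: "('m::finite, 'n::finite, 'k::finite, 'j::finite) dro_problem \<Rightarrow> nat \<Rightarrow> real" where
  "lower_mass M N = (\<Sum>j\<in>UNIV. p_lower M N j)"

definition upper_mass :: "('m::finite, 'n::finite, 'k::finite, 'j::finite) dro_problem \<Rightarrow> nat \<Rightarrow> real" where
  "upper_mass M N = (\<Sum>j\<in>UNIV. p_upper M N j)"

definition p_l :: "('m::finite, 'n::finite, 'k::finite, 'j::finite) dro_problem \<Rightarrow> nat \<Rightarrow> 'j \<Rightarrow> real" where
  "p_l M N j = p_lower M N j / lower_mass M N"

definition p_ul :: "('m::finite, 'n::finite, 'k::finite, 'j::finite) dro_problem \<Rightarrow> nat \<Rightarrow> 'j \<Rightarrow> real" where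
  "p_ul M N j = (p_upper M N j - p_lower M N j) / (upper_mass M N - lower_mass M N)"

definition lam :: "('m::finite, 'n::finite, 'k::finite, 'j::finite) dro_problem \<Rightarrow> nat \<Rightarrow> real" where
  "lam M N = lower_mass M N"

definition ups :: "('m::finite, 'n::finite, 'k::finite, 'j::finite) dro_problem \<Rightarrow> nat \<Rightarrow> real" where
  "ups M N = (upper_mass M N - 1) / (upper_mass M N - lower_mass M N)"

definition bellman ::
  "('m::finite, 'n::finite, 'k::finite, 'j::finite) dro_problem \<Rightarrow> nat \<Rightarrow> (real ^ 'm \<Rightarrow> real) \<Rightarrow> real ^ 'm \<Rightarrow> real" where
  "bellman M N V s =
     (INF a\<in>actions M. SUP p\<in>ambiguity_set M N.
        \<Sum>j\<in>UNIV. p $ j * (cost M s a (scenario M j) + discount M * V (dynamics M s a (scenario M j))))"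

definition bounded_fixed_point ::
  "('m::finite, 'n::finite, 'k::finite, 'j::finite) dro_problem \<Rightarrow> nat \<Rightarrow> (real ^ 'm \<Rightarrow> real) \<Rightarrow> bool" where
  "bounded_fixed_point M N V \<longleftrightarrow> bounded (V ` states M) \<and> (\<forall>s\<in>states M. bellman M N V s = V s)"

definition sup_norm_on :: "'a set \<Rightarrow> ('a \<Rightarrow> real) \<Rightarrow> real" where
  "sup_norm_on D f = (SUP x\<in>D. \<bar>f x\<bar>)"

text \<open>Subdifferential of a convex function whose domain is \<open>D\<close> (that is, of its extension by
  $+\infty$ outside \<open>D\<close>).\<close>

definition subdifferential :: "'a::real_inner set \<Rightarrow> ('a \<Rightarrow> real) \<Rightarrow> 'a \<Rightarrow> 'a set" where
  "subdifferential D f x = {v. \<forall>y\<in>D. f x + v \<bullet> (y - x) \<le> f y}"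

text \<open>The state block $\partial_s \mathcal C^j(s,a)$ of the joint subdifferential over
  $\mathcal S \times \mathcal A$.\<close>

definition cost_subdifferential_state ::
  "('m::finite, 'n::finite, 'k::finite, 'j::finite) dro_problem \<Rightarrow> 'j \<Rightarrow> real ^ 'm \<Rightarrow> real ^ 'n \<Rightarrow> (real ^ 'm) set" where
  "cost_subdifferential_state M j s a =
     fst ` subdifferential (states M \<times> actions M) (\<lambda>(s, a). cost M s a (scenario M j)) (s, a)"

definition next_state ::
  "('m::finite, 'n::finite, 'k::finite, 'j::finite) dro_problem \<Rightarrow> real ^ 'm \<Rightarrow> real ^ 'n \<Rightarrow> 'j \<Rightarrow> real ^ 'm" where
  "next_state M s a j = matA M (scenario M j) *v s + matB M (scenario M j) *v a + vecb M (scenario M j)"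

definition cost_to_go ::
  "('m::finite, 'n::finite, 'k::finite, 'j::finite) dro_problem \<Rightarrow> (real ^ 'm \<Rightarrow> real) \<Rightarrow> real ^ 'm \<Rightarrow> real ^ 'n \<Rightarrow> 'j \<Rightarrow> real" where
  "cost_to_go M V s a j = cost M s a (scenario M j) + discount M * V (next_state M s a j)"

definition objective ::
  "('m::finite, 'n::finite, 'k::finite, 'j::finite) dro_problem \<Rightarrow> nat \<Rightarrow> (real ^ 'm \<Rightarrow> real) \<Rightarrow> real ^ 'm
     \<Rightarrow> real ^ 'n \<Rightarrow> real \<Rightarrow> real ^ 'j \<Rightarrow> real" where
  "objective M N V s a \<zeta> y =
     lam M N * (\<Sum>j\<in>UNIV. p_l M N j * cost_to_go M V s a j) + (1 - lam M N) * \<zeta>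
       + (1 - lam M N) / (1 - ups M N) * (\<Sum>j\<in>UNIV. p_ul M N j * y $ j)"

definition feasible ::
  "('m::finite, 'n::finite, 'k::finite, 'j::finite) dro_problem \<Rightarrow> (real ^ 'm \<Rightarrow> real) \<Rightarrow> real ^ 'm
     \<Rightarrow> real ^ 'n \<Rightarrow> real \<Rightarrow> real ^ 'j \<Rightarrow> bool" where
  "feasible M V s a \<zeta> y \<longleftrightarrow> a \<in> actions M \<and> (\<forall>j. 0 \<le> y $ j \<and> cost_to_go M V s a j - \<zeta> \<le> y $ j)"

definition minimizer ::
  "('m::finite, 'n::finite, 'k::finite, 'j::finite) dro_problem \<Rightarrow> nat \<Rightarrow> (real ^ 'm \<Rightarrow> real) \<Rightarrow> real ^ 'm
     \<Rightarrow> real ^ 'n \<Rightarrow> real \<Rightarrow> real ^ 'j \<Rightarrow> bool" where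
  "minimizer M N V s a \<zeta> y \<longleftrightarrow>
     feasible M V s a \<zeta> y \<and>
     (\<forall>a' \<zeta>' y'. feasible M V s a' \<zeta>' y' \<longrightarrow> objective M N V s a \<zeta> y \<le> objective M N V s a' \<zeta>' y')"

definition lagrangian ::
  "('m::finite, 'n::finite, 'k::finite, 'j::finite) dro_problem \<Rightarrow> nat \<Rightarrow> (real ^ 'm \<Rightarrow> real) \<Rightarrow> real ^ 'm
     \<Rightarrow> real ^ 'j \<Rightarrow> real ^ 'j \<Rightarrow> real ^ 'n \<Rightarrow> real \<Rightarrow> real ^ 'j \<Rightarrow> real" where
  "lagrangian M N V s \<mu> \<nu> a \<zeta> y =
     objective M N V s a \<zeta> y + (\<Sum>j\<in>UNIV. \<mu> $ j * (cost_to_go M V s a j - \<zeta> - y $ j)) - (\<Sum>j\<in>UNIV. \<nu> $ j * y $ j)"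

text \<open>KKT conditions of the convex program at a primal solution: dual feasibility, complementary
  slackness and stationarity. The data need not be differentiable and \<open>a \<in> actions M\<close> is kept as an
  abstract constraint, so stationarity says that the primal solution minimizes the Lagrangian. The
  sign constraint on $y$ is dualized by \<open>\<nu>\<close>, hence $y$ is unrestricted there.\<close>

definition kkt_multipliers ::
  "('m::finite, 'n::finite, 'k::finite, 'j::finite) dro_problem \<Rightarrow> nat \<Rightarrow> (real ^ 'm \<Rightarrow> real) \<Rightarrow> real ^ 'm
     \<Rightarrow> real ^ 'n \<Rightarrow> real \<Rightarrow> real ^ 'j \<Rightarrow> real ^ 'j \<Rightarrow> real ^ 'j \<Rightarrow> bool" where
  "kkt_multipliers M N V s a \<zeta> y \<mu> \<nu> \<longleftrightarrow>
     (\<forall>j. 0 \<le> \<mu> $ j \<and> 0 \<le> \<nu> $ j) \<and>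
     (\<forall>j. \<mu> $ j * (cost_to_go M V s a j - \<zeta> - y $ j) = 0 \<and> \<nu> $ j * y $ j = 0) \<and>
     (\<forall>a'\<in>actions M. \<forall>\<zeta>' y'. lagrangian M N V s \<mu> \<nu> a \<zeta> y \<le> lagrangian M N V s \<mu> \<nu> a' \<zeta>' y')"

definition theta ::
  "('m::finite, 'n::finite, 'k::finite, 'j::finite) dro_problem \<Rightarrow> nat \<Rightarrow> real ^ 'j \<Rightarrow> 'j \<Rightarrow> real" where
  "theta M N \<mu> j = (1 - ups M N) * \<mu> $ j / ((1 - lam M N) * p_ul M N j)"

definition cut_value ::
  "('m::finite, 'n::finite, 'k::finite, 'j::finite) dro_problem \<Rightarrow> nat \<Rightarrow> (real ^ 'm \<Rightarrow> real) \<Rightarrow> real ^ 'm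
     \<Rightarrow> real ^ 'n \<Rightarrow> real \<Rightarrow> real" where
  "cut_value M N V s a \<zeta> =
     lam M N * (\<Sum>j\<in>UNIV. p_l M N j * cost_to_go M V s a j) + (1 - lam M N) * \<zeta>
       + (1 - lam M N) / (1 - ups M N) * (\<Sum>j\<in>UNIV. p_ul M N j * max 0 (cost_to_go M V s a j - \<zeta>))"

definition operator_subgradients ::
  "('m::finite, 'n::finite, 'k::finite, 'j::finite) dro_problem \<Rightarrow> nat \<Rightarrow> (real ^ 'm \<Rightarrow> real) \<Rightarrow> real ^ 'm
     \<Rightarrow> real ^ 'n \<Rightarrow> real ^ 'j \<Rightarrow> (real ^ 'm) set" where
  "operator_subgradients M N V s a \<mu> =
     {(\<Sum>j\<in>UNIV. (lam M N * p_l M N j + (1 - lam M N) / (1 - ups M N) * p_ul M N j * theta M N \<mu> j)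
                   *\<^sub>R (u j + discount M *\<^sub>R (transpose (matA M (scenario M j)) *v w j))) | u w.
        \<forall>j. u j \<in> cost_subdifferential_state M j s a \<and>
            w j \<in> subdifferential (states M) V (next_state M s a j)}"

definition cut :: "real \<Rightarrow> real ^ 'm::finite \<Rightarrow> real ^ 'm \<Rightarrow> real ^ 'm \<Rightarrow> real" where
  "cut v q s0 s = v + q \<bullet> (s - s0)"

text \<open>One iteration from \<open>(s, V)\<close> to \<open>(s', V')\<close> when scenario \<open>i\<close> is drawn; the minimizer, the
  multipliers and the subgradient may be chosen arbitrarily among the admissible ones.\<close>

definition bocp_step ::
  "('m::finite, 'n::finite, 'k::finite, 'j::finite) dro_problem \<Rightarrow> nat \<Rightarrow> 'j
     \<Rightarrow> real ^ 'm \<Rightarrow> (real ^ 'm \<Rightarrow> real) \<Rightarrow> real ^ 'm \<Rightarrow> (real ^ 'm \<Rightarrow> real) \<Rightarrow> bool" where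
  "bocp_step M N i s V s' V' \<longleftrightarrow>
     (\<exists>a \<zeta> y \<mu> \<nu> q.
        minimizer M N V s a \<zeta> y \<and>
        kkt_multipliers M N V s a \<zeta> y \<mu> \<nu> \<and>
        q \<in> operator_subgradients M N V s a \<mu> \<and>
        (\<forall>t\<in>states M. cut (cut_value M N V s a \<zeta>) q s t \<le> bellman M N V t) \<and>
        V' = (\<lambda>t. max (V t) (cut (cut_value M N V s a \<zeta>) q s t)) \<and>
        s' = next_state M s a i)"

definition bocp_run ::
  "('m::finite, 'n::finite, 'k::finite, 'j::finite) dro_problem \<Rightarrow> nat \<Rightarrow> real ^ 'm \<Rightarrow> (nat \<Rightarrow> 'j)
     \<Rightarrow> (nat \<Rightarrow> real ^ 'm) \<Rightarrow> (nat \<Rightarrow> real ^ 'm \<Rightarrow> real) \<Rightarrow> bool" where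
  "bocp_run M N s0 d sb V \<longleftrightarrow>
     sb 0 = s0 \<and> V 0 = (\<lambda>_. - cost_bound M / (1 - discount M)) \<and>
     (\<forall>k. bocp_step M N (d k) (sb k) (V k) (sb (Suc k)) (V (Suc k)))"

end

(* The iterates increase and stay below the fixed point, because every cut lies below the Bellman
   update of a function that lies below the fixed point. By Dini's theorem the convergence to the
   continuous limit V is uniform. At the trial state each cut is at least the Bellman update of the
   current iterate, and the trial states visit every neighbourhood infinitely often; passing to
   the limit gives V >= LV everywhere for the Bellman operator L. Since L is monotone and shifts
   constants by the discount factor, V >= LV implies that V dominates the fixed point. *)

theory Submission
  imports Defs
begin

section \<open>Uniform convergence and almost sure visits\<close>

text \<open>If uniformity failed, there would be points \<open>x n\<close> where the gap at index
  \<open>n\<close> is at least \<open>e\<close>. By monotonicity the gap at every earlier index is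
  at least \<open>e\<close> there too, so a limit point of the \<open>x n\<close> keeps a gap of
  \<open>e\<close> at all indices, against pointwise convergence.\<close>

lemma Dini_mono:
  fixes f :: "nat \<Rightarrow> 'a::metric_space \<Rightarrow> real"
  assumes "compact S" and cont: "\<And>n. continuous_on S (f n)" "continuous_on S g"
    and mono: "\<And>x. x \<in> S \<Longrightarrow> incseq (\<lambda>n. f n x)"
    and lim: "\<And>x. x \<in> S \<Longrightarrow> (\<lambda>n. f n x) \<longlonglongrightarrow> g x"
    and "0 < e"
  shows "\<exists>n. \<forall>m\<ge>n. \<forall>x\<in>S. g x - f m x < e"
proof (rule ccontr)
  assume contra: "\<not> ?thesis"
  have "\<exists>x. x \<in> S \<and> e \<le> g x - f n x" for n
  proof -
    obtain m x where "n \<le> m" "x \<in> S" "\<not> g x - f m x < e"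
      using contra by blast
    then show ?thesis
      using incseqD[OF mono, of x n m] by (intro exI[of _ x]) auto
  qed
  then obtain x where x: "\<And>n. x n \<in> S" "\<And>n. e \<le> g (x n) - f n (x n)"
    by metis
  obtain l r where l: "l \<in> S" "strict_mono r" and r: "(x \<circ> r) \<longlonglongrightarrow> l"
    using \<open>compact S\<close> x(1) unfolding compact_def by blast
  have "e \<le> g l - f n l" for n
  proof (rule tendsto_lowerbound)
    have "continuous_on S (\<lambda>x. g x - f n x)"
      by (intro continuous_intros cont)
    then show "(\<lambda>k. g (x (r k)) - f n (x (r k))) \<longlonglongrightarrow> g l - f n l"
      using continuous_on_tendsto_compose[of S "\<lambda>x. g x - f n x" "x \<circ> r" l sequentially] l(1) r x(1)
      by (simp add: o_def)
    show "\<forall>\<^sub>F k in sequentially. e \<le> g (x (r k)) - f n (x (r k))"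
    \<comment> \<open>The index \<open>n\<close> is fixed while the points move: from
      \<open>k = n\<close> on, \<open>r k\<close> is at least \<open>n\<close>, so the gap at index
      \<open>r k\<close> passes down to index \<open>n\<close>.\<close>
    proof (rule eventually_sequentiallyI[of n])
      fix k assume "n \<le> k"
      then have "n \<le> r k"
        using seq_suble[OF l(2), of k] by simp
      then show "e \<le> g (x (r k)) - f n (x (r k))"
        using x(2)[of "r k"] incseqD[OF mono[OF x(1)], of n "r k" "r k"] by linarith
    qed
  qed simp
  moreover have "(\<lambda>n. g l - f n l) \<longlonglongrightarrow> 0"
    using tendsto_diff[OF tendsto_const lim[OF l(1)], of "g l"] by simp
  ultimately have "e \<le> 0"
    using tendsto_lowerbound[of "\<lambda>n. g l - f n l" 0 sequentially e] by simp
  with \<open>0 < e\<close> show False by simp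
qed

lemma sup_norm_on_diff_tendsto_0:
  assumes "D \<noteq> {}" and below: "\<And>n x. x \<in> D \<Longrightarrow> f n x \<le> g x"
    and unif: "\<And>e. 0 < e \<Longrightarrow> \<exists>n. \<forall>m\<ge>n. \<forall>x\<in>D. g x - f m x < e"
  shows "(\<lambda>n. sup_norm_on D (\<lambda>x. f n x - g x)) \<longlonglongrightarrow> 0"
proof (rule LIMSEQ_I)
  fix e :: real assume "0 < e"
  then obtain n where n: "\<And>m x. n \<le> m \<Longrightarrow> x \<in> D \<Longrightarrow> g x - f m x < e / 2"
    \<comment> \<open>Taking the supremum weakens the strict bound to a weak one; half of
      \<open>e\<close> leaves room for this.\<close>
    using unif[of "e / 2"] by auto
  have "norm (sup_norm_on D (\<lambda>x. f m x - g x) - 0) < e" if "n \<le> m" for m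
  proof -
    have *: "\<bar>f m x - g x\<bar> \<le> e / 2" if "x \<in> D" for x
      using n[OF \<open>n \<le> m\<close> that] below[OF that, of m] by linarith
    have bdd: "bdd_above ((\<lambda>x. \<bar>f m x - g x\<bar>) ` D)"
      using * by (rule bdd_aboveI2)
    obtain x where "x \<in> D" using \<open>D \<noteq> {}\<close> by auto
    then have "0 \<le> (SUP x\<in>D. \<bar>f m x - g x\<bar>)"
      by (rule cSUP_upper2[OF bdd]) simp
    moreover have "(SUP x\<in>D. \<bar>f m x - g x\<bar>) \<le> e / 2"
      by (rule cSUP_least[OF \<open>D \<noteq> {}\<close> *])
    ultimately show ?thesis
      unfolding sup_norm_on_def using \<open>0 < e\<close> by simp
  qed
  then show "\<exists>n. \<forall>m\<ge>n. norm (sup_norm_on D (\<lambda>x. f m x - g x) - 0) < e" by blast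
qed

text \<open>The null set in the hypothesis depends on \<open>s\<close>, \<open>e\<close> and
  \<open>K\<close>. A countable dense subset of \<open>S\<close> and the radii 1/(n+1) leave
  countably many null sets, and the triangle inequality recovers arbitrary points and radii.\<close>

lemma AE_dense_visits:
  fixes X :: "nat \<Rightarrow> 'w \<Rightarrow> 'a::euclidean_space"
  assumes "\<And>s e K. s \<in> S \<Longrightarrow> 0 < e \<Longrightarrow> AE \<omega> in \<Omega>. \<exists>k\<ge>K. norm (X k \<omega> - s) < e"
  shows "AE \<omega> in \<Omega>. \<forall>s\<in>S. \<forall>e>0. \<forall>K. \<exists>k\<ge>K. norm (X k \<omega> - s) < e"
proof -
  obtain T where T: "countable T" "T \<subseteq> S" "S \<subseteq> closure T"
    using separable by blast
  have "AE \<omega> in \<Omega>. \<forall>t\<in>T. \<forall>n K. \<exists>k\<ge>K. norm (X k \<omega> - t) < inverse (real (Suc n))"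
    using T(2) by (subst AE_ball_countable[OF T(1)]) (auto simp: AE_all_countable intro!: assms)
  then show ?thesis
  proof (eventually_elim, intro ballI allI impI)
    fix \<omega> s K and e :: real
    assume visits: "\<forall>t\<in>T. \<forall>n K. \<exists>k\<ge>K. norm (X k \<omega> - t) < inverse (real (Suc n))"
      and "s \<in> S" and "0 < e"
    obtain t where t: "t \<in> T" "dist t s < e / 2"
      using \<open>s \<in> S\<close> T(3) \<open>0 < e\<close> closure_approachable[of s T] by (metis half_gt_zero subsetD)
    obtain n where n: "inverse (real (Suc n)) < e / 2"
      using \<open>0 < e\<close> reals_Archimedean[of "e / 2"] by auto
    obtain k where k: "k \<ge> K" "norm (X k \<omega> - t) < inverse (real (Suc n))"
      using visits t(1) by blast
    have "norm (X k \<omega> - s) \<le> norm (X k \<omega> - t) + norm (t - s)"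
      using norm_triangle_ineq[of "X k \<omega> - t" "t - s"] by simp
    then show "\<exists>k\<ge>K. norm (X k \<omega> - s) < e"
      using k n t(2) by (intro exI[of _ k]) (simp add: dist_norm)
  qed
qed

section \<open>Worst-case expectations over sets of probability vectors\<close>

text \<open>The inner supremum of \<open>bellman\<close>, as a functional of the vector of scenario
  values alone.\<close>

definition worst_case :: "(real ^ 'j::finite) set \<Rightarrow> ('j \<Rightarrow> real) \<Rightarrow> real" where
  "worst_case P h = (SUP p\<in>P. \<Sum>j\<in>UNIV. p $ j * h j)"

lemma prob_vectors_expectation_le:
  assumes "p \<in> prob_vectors" and "\<And>j. h j \<le> h' j + c"
  shows "(\<Sum>j\<in>UNIV. p $ j * h j) \<le> (\<Sum>j\<in>UNIV. p $ j * h' j) + c"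
proof -
  have "(\<Sum>j\<in>UNIV. p $ j * h j) \<le> (\<Sum>j\<in>UNIV. p $ j * (h' j + c))"
    using assms by (intro sum_mono mult_left_mono) (auto simp: prob_vectors_def)
  also have "\<dots> = (\<Sum>j\<in>UNIV. p $ j * h' j) + c"
    using assms(1) by (simp add: distrib_left sum.distrib prob_vectors_def flip: sum_distrib_right)
  finally show ?thesis .
qed

lemma bdd_above_expectation:
  fixes P :: "(real ^ 'j::finite) set"
  assumes "P \<subseteq> prob_vectors"
  shows "bdd_above ((\<lambda>p. \<Sum>j\<in>UNIV. p $ j * h j) ` P)"
proof (rule bdd_aboveI2)
  fix p assume "p \<in> P"
  then have "p \<in> prob_vectors" using assms by auto
  then show "(\<Sum>j\<in>UNIV. p $ j * h j) \<le> Max (range h)"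
    using prob_vectors_expectation_le[of p h "\<lambda>_. 0" "Max (range h)"] by simp
qed

text \<open>Monotonicity (\<open>c = 0\<close>) and compatibility with constants in one inequality;
  the masses of each \<open>p\<close> sum to one, so a constant passes through the
  expectation.\<close>

lemma worst_case_le:
  assumes "P \<subseteq> prob_vectors" "P \<noteq> {}" and "\<And>j. h j \<le> h' j + c"
  shows "worst_case P h \<le> worst_case P h' + c"
  unfolding worst_case_def
proof (rule cSUP_least[OF \<open>P \<noteq> {}\<close>])
  fix p assume p: "p \<in> P"
  then have "(\<Sum>j\<in>UNIV. p $ j * h j) \<le> (\<Sum>j\<in>UNIV. p $ j * h' j) + c"
    using assms by (intro prob_vectors_expectation_le) auto
  also have "(\<Sum>j\<in>UNIV. p $ j * h' j) \<le> (SUP p\<in>P. \<Sum>j\<in>UNIV. p $ j * h' j)"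
    by (rule cSUP_upper[OF p bdd_above_expectation[OF assms(1)]])
  finally show "(\<Sum>j\<in>UNIV. p $ j * h j) \<le> (SUP p\<in>P. \<Sum>j\<in>UNIV. p $ j * h' j) + c" by simp
qed

lemma worst_case_const:
  assumes "P \<subseteq> prob_vectors" "P \<noteq> {}"
  shows "worst_case P (\<lambda>_. c) = c"
proof -
  have "(\<Sum>j\<in>UNIV. p $ j * c) = c" if "p \<in> P" for p
    using that assms(1) by (auto simp: prob_vectors_def simp flip: sum_distrib_right)
  then show ?thesis
    unfolding worst_case_def using assms(2) by simp
qed

section \<open>Problem data and the ambiguity set\<close>

text \<open>The operator \<open>bellman\<close> is written with \<open>dynamics\<close> and the
  algorithm with \<open>next_state\<close>; \<open>dynamics_affine\<close> identifies the two on
  admissible arguments.\<close>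

locale dro =
  fixes M :: "('m::finite, 'n::finite, 'k::finite, 'j::finite) dro_problem" and N :: nat
  assumes states_nonempty: "states M \<noteq> {}" and actions_nonempty: "actions M \<noteq> {}"
    and dynamics_in_states: "\<And>s a j. s \<in> states M \<Longrightarrow> a \<in> actions M \<Longrightarrow> dynamics M s a (scenario M j) \<in> states M"
    and dynamics_affine: "\<And>s a j. s \<in> states M \<Longrightarrow> a \<in> actions M \<Longrightarrow> dynamics M s a (scenario M j) = next_state M s a j"
    and discount: "0 \<le> discount M" "discount M < 1"
    and bdd_cost: "bdd_above ((\<lambda>(s, a, \<xi>). \<bar>cost M s a \<xi>\<bar>) ` (states M \<times> actions M \<times> scenarios M))"
    and prior: "\<And>j. 1 < prior M j"
    and lower_mass: "0 < lower_mass M N" "lower_mass M N < 1" and upper_mass: "1 < upper_mass M N"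
    and compact_states: "compact (states M)" and compact_actions: "compact (actions M)"
    and continuous_cost: "\<And>j. continuous_on (states M \<times> actions M) (\<lambda>(s, a). cost M s a (scenario M j))"
begin

abbreviation "\<gamma> \<equiv> discount M"
abbreviation "P \<equiv> ambiguity_set M N"
abbreviation "bdd V \<equiv> bounded (V ` states M)"

lemma next_state_in_states: "s \<in> states M \<Longrightarrow> a \<in> actions M \<Longrightarrow> next_state M s a j \<in> states M"
  using dynamics_in_states[of s a j] dynamics_affine[of s a j] by simp

lemma cost_bound: "s \<in> states M \<Longrightarrow> a \<in> actions M \<Longrightarrow> \<bar>cost M s a (scenario M j)\<bar> \<le> cost_bound M"
  unfolding cost_bound_def using cSUP_upper[OF _ bdd_cost, of "(s, a, scenario M j)"] by auto

lemma posterior_gt_1: "1 < posterior M N j"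
proof -
  have "0 \<le> (\<Sum>i = 1..N. if obs M i = scenario M j then 1 else (0::real))"
    by (rule sum_nonneg) simp
  then show ?thesis using prior[of j] unfolding posterior_def by linarith
qed

lemma posterior_size_eq: "posterior_size M N = (\<Sum>j\<in>UNIV. posterior M N j - 1)"
  by (simp add: posterior_size_def sum_subtractf)

lemma posterior_size_pos: "0 < posterior_size M N"
  unfolding posterior_size_eq using posterior_gt_1 by (intro sum_pos) auto

lemma p_hat_nonneg: "0 \<le> p_hat M N j"
  using posterior_gt_1[of j] posterior_size_pos by (simp add: p_hat_def)

lemma sum_p_hat: "(\<Sum>j\<in>UNIV. p_hat M N j) = 1"
  using posterior_size_pos by (simp add: p_hat_def posterior_size_eq flip: sum_divide_distrib)

lemma p_hat_le_1: "p_hat M N j \<le> 1"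
  using member_le_sum[of j UNIV "p_hat M N"] by (simp add: p_hat_nonneg sum_p_hat)

text \<open>The radii share the sign of the normal quantile. Were it negative, the lower bounds would
  dominate \<open>p_hat\<close> and their mass would be at least one.\<close>

lemma r_hat_nonneg: "0 \<le> r_hat M N j"
proof -
  define z where "z = std_normal_quantile (1 - level M / real CARD('j) / 2)"
  have r: "r_hat M N i = z * sqrt (p_hat M N i * (1 - p_hat M N i) / posterior_size M N)" for i
    by (simp add: r_hat_def z_def Let_def)
  have root: "0 \<le> sqrt (p_hat M N i * (1 - p_hat M N i) / posterior_size M N)" for i
    using p_hat_nonneg[of i] p_hat_le_1[of i] posterior_size_pos by simp
  have "0 \<le> z"
  proof (rule ccontr)
    assume "\<not> 0 \<le> z"
    then have "r_hat M N i \<le> 0" for i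
      unfolding r using root by (intro mult_nonpos_nonneg) auto
    then have "p_hat M N i \<le> p_lower M N i" for i
      by (simp add: p_lower_def le_max_iff_disj)
    then have "1 \<le> lower_mass M N"
      unfolding lower_mass_def sum_p_hat[symmetric] by (intro sum_mono)
    then show False using lower_mass by simp
  qed
  then show ?thesis unfolding r using root by simp
qed

lemma ambiguity_subset: "P \<subseteq> prob_vectors"
  by (auto simp: ambiguity_set_def)

text \<open>Nonnegative radii put the centre \<open>p_hat\<close> into the box. Without a member,
  the real supremum in \<open>worst_case\<close> would be an unspecified value.\<close>

lemma ambiguity_nonempty: "P \<noteq> {}"
proof -
  have "(\<chi> j. p_hat M N j) \<in> P"
    using r_hat_nonneg p_hat_nonneg sum_p_hat by (simp add: ambiguity_set_def prob_vectors_def)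
  then show ?thesis by blast
qed

lemmas worst_case_ambiguity_le = worst_case_le[OF ambiguity_subset ambiguity_nonempty]

section \<open>Monotonicity, contraction and comparison for the Bellman operator\<close>

lemma bellman_eq:
  assumes "s \<in> states M"
  shows "bellman M N V s = (INF a\<in>actions M. worst_case P (cost_to_go M V s a))"
  unfolding bellman_def worst_case_def cost_to_go_def
  by (rule INF_cong) (auto simp: dynamics_affine[OF assms])

lemma bdd_below_worst_case:
  assumes "bdd V" and s: "s \<in> states M"
  shows "bdd_below ((\<lambda>a. worst_case P (cost_to_go M V s a)) ` actions M)"
proof -
  obtain B where B: "\<And>t. t \<in> states M \<Longrightarrow> \<bar>V t\<bar> \<le> B"
    using assms(1) by (auto simp: bounded_iff)
  show ?thesis
  proof (rule bdd_belowI2)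
    fix a assume a: "a \<in> actions M"
    \<comment> \<open>The left side is read as a constant function of \<open>j\<close>, whose worst
      case is that constant; \<open>+ 0\<close> fits the shape of
      \<open>worst_case_le\<close>.\<close>
    have "- (cost_bound M + \<gamma> * B) \<le> cost_to_go M V s a j + 0" for j
    proof -
      have "\<gamma> * - V (next_state M s a j) \<le> \<gamma> * B"
        using B[OF next_state_in_states[OF s a, of j]] discount by (intro mult_left_mono) auto
      then show ?thesis
        using cost_bound[OF s a, of j] by (auto simp: cost_to_go_def)
    qed
    from worst_case_ambiguity_le[OF this]
    show "- (cost_bound M + \<gamma> * B) \<le> worst_case P (cost_to_go M V s a)"
      by (simp add: worst_case_const[OF ambiguity_subset ambiguity_nonempty])
  qed
qed

lemma bellman_le_worst_case:
  assumes "bdd V" "s \<in> states M" "a \<in> actions M"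
  shows "bellman M N V s \<le> worst_case P (cost_to_go M V s a)"
  unfolding bellman_eq[OF assms(2)]
  by (rule cINF_lower[OF bdd_below_worst_case[OF assms(1,2)] assms(3)])

text \<open>Allowing both the function and the state to change covers two uses:
  \<open>s = s'\<close> gives the contraction estimate, \<open>V = V'\<close> the continuity in the
  state.\<close>

lemma bellman_le:
  assumes "bdd V" and s: "s \<in> states M" "s' \<in> states M"
    and le: "\<And>a j. a \<in> actions M \<Longrightarrow> cost_to_go M V s a j \<le> cost_to_go M V' s' a j + c"
  shows "bellman M N V s \<le> bellman M N V' s' + c"
proof -
  have "bellman M N V s - c \<le> worst_case P (cost_to_go M V' s' a)" if a: "a \<in> actions M" for a
    using bellman_le_worst_case[OF assms(1) s(1) a] 
      worst_case_ambiguity_le[of "cost_to_go M V s a", OF le[OF a]] by simp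
  then have "bellman M N V s - c \<le> bellman M N V' s'"
    unfolding bellman_eq[OF s(2)] by (intro cINF_greatest[OF actions_nonempty])
  then show ?thesis by simp
qed

text \<open>With \<open>d = 0\<close> this is monotonicity; in general it is the one-sided
  contraction estimate.\<close>

lemma bellman_shift:
  assumes "bdd V" "s \<in> states M" and "\<And>t. t \<in> states M \<Longrightarrow> V t \<le> V' t + d"
  shows "bellman M N V s \<le> bellman M N V' s + \<gamma> * d"
proof (rule bellman_le[OF assms(1,2,2)])
  fix a j assume "a \<in> actions M"
  then have "\<gamma> * V (next_state M s a j) \<le> \<gamma> * (V' (next_state M s a j) + d)"
    using assms discount next_state_in_states by (intro mult_left_mono) auto
  then show "cost_to_go M V s a j \<le> cost_to_go M V' s a j + \<gamma> * d"
    by (simp add: cost_to_go_def distrib_left)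
qed

text \<open>A subsolution lies below a supersolution: the largest excess \<open>d\<close> of
  \<open>W\<close> over \<open>V\<close> satisfies d \<le> \<gamma> d with \<gamma> < 1, hence is
  not positive.\<close>

lemma bellman_comparison:
  assumes "bdd W" "bdd V"
    and sub: "\<And>s. s \<in> states M \<Longrightarrow> W s \<le> bellman M N W s"
    and super: "\<And>s. s \<in> states M \<Longrightarrow> bellman M N V s \<le> V s"
    and "s \<in> states M"
  shows "W s \<le> V s"
proof -
  define d where "d = (SUP t\<in>states M. W t - V t)"
  have "bounded ((\<lambda>t. W t - V t) ` states M)"
    using bounded_minus_comp[OF assms(1,2)] by simp
  then have d: "W t - V t \<le> d" if "t \<in> states M" for t
    unfolding d_def using that by (intro cSUP_upper bounded_imp_bdd_above)
  have "W t - V t \<le> \<gamma> * d" if t: "t \<in> states M" for t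
  proof -
    have "bellman M N W t \<le> bellman M N V t + \<gamma> * d"
      using d by (intro bellman_shift[OF assms(1) t]) (simp add: diff_le_eq add.commute)
    then show ?thesis using sub[OF t] super[OF t] by linarith
  qed
  then have "d \<le> \<gamma> * d"
    unfolding d_def using states_nonempty by (intro cSUP_least) auto
  then have "(1 - \<gamma>) * d \<le> 0" by (simp add: algebra_simps)
  then have "d \<le> 0" using discount by (simp add: mult_le_0_iff)
  then show ?thesis using d[OF \<open>s \<in> states M\<close>] by simp
qed

text \<open>Weak duality for the linear program over the ambiguity set: since \<open>p\<close> and its lower bound
  differ by the mass \<open>1 - lower_mass\<close>, any \<open>\<zeta>\<close> may be split off.\<close>

lemma worst_case_le_cut_value:
  "worst_case P (cost_to_go M V s a) \<le> cut_value M N V s a \<zeta>"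
proof -
  let ?h = "cost_to_go M V s a" and ?l = "p_lower M N" and ?u = "p_upper M N"
  have gap: "0 < upper_mass M N - lower_mass M N"
    using lower_mass upper_mass by simp
  have "1 - ups M N = (1 - lower_mass M N) / (upper_mass M N - lower_mass M N)"
    using gap by (simp add: ups_def field_simps)
  \<comment> \<open>This coefficient cancels the normalization of \<open>p_ul\<close>, so
    \<open>cut_value\<close> becomes an expression in the unnormalized bounds.\<close>
  then have factor: "(1 - lam M N) / (1 - ups M N) = upper_mass M N - lower_mass M N"
    using lower_mass by (simp add: lam_def)
  have "lam M N * (\<Sum>j\<in>UNIV. p_l M N j * ?h j) = (\<Sum>j\<in>UNIV. ?l j * ?h j)"
    using lower_mass by (simp add: lam_def p_l_def sum_distrib_left)
  moreover have "(1 - lam M N) / (1 - ups M N) * (\<Sum>j\<in>UNIV. p_ul M N j * max 0 (?h j - \<zeta>))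
      = (\<Sum>j\<in>UNIV. (?u j - ?l j) * max 0 (?h j - \<zeta>))"
    unfolding factor using gap by (simp add: p_ul_def sum_distrib_left)
  ultimately have cv: "cut_value M N V s a \<zeta> = (\<Sum>j\<in>UNIV. ?l j * ?h j) + (1 - lower_mass M N) * \<zeta>
      + (\<Sum>j\<in>UNIV. (?u j - ?l j) * max 0 (?h j - \<zeta>))"
    by (simp add: cut_value_def lam_def)
  show ?thesis
    unfolding worst_case_def
  proof (rule cSUP_least[OF ambiguity_nonempty])
    fix p assume p: "p \<in> P"
    then have sum_p: "(\<Sum>j\<in>UNIV. p $ j) = 1" and p_nonneg: "\<And>j. 0 \<le> p $ j"
      by (auto simp: ambiguity_set_def prob_vectors_def)
    \<comment> \<open>Needed because \<open>p_upper\<close> is truncated at one.\<close>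
    have "p $ j \<le> 1" for j
      using member_le_sum[of j UNIV "($) p"] p_nonneg sum_p by simp
    then have bounds: "?l j \<le> p $ j" "p $ j \<le> ?u j" for j
      using p p_nonneg by (auto simp: ambiguity_set_def p_lower_def p_upper_def)
    \<comment> \<open>The mass above the lower bound is charged \<zeta>, and the remainder h -
      \<zeta> is kept separately.\<close>
    have "(\<Sum>j\<in>UNIV. p $ j * ?h j) = (\<Sum>j\<in>UNIV. ?l j * ?h j) + (\<Sum>j\<in>UNIV. p $ j - ?l j) * \<zeta>
        + (\<Sum>j\<in>UNIV. (p $ j - ?l j) * (?h j - \<zeta>))"
      by (simp add: sum_distrib_right flip: sum.distrib) (simp add: algebra_simps)
    also have "(\<Sum>j\<in>UNIV. p $ j - ?l j) = 1 - lower_mass M N"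
      by (simp add: sum_subtractf sum_p lower_mass_def)
    also have "(\<Sum>j\<in>UNIV. (p $ j - ?l j) * (?h j - \<zeta>))
        \<le> (\<Sum>j\<in>UNIV. (?u j - ?l j) * max 0 (?h j - \<zeta>))"
    proof (rule sum_mono)
      fix j
      have "(p $ j - ?l j) * (?h j - \<zeta>) \<le> (p $ j - ?l j) * max 0 (?h j - \<zeta>)"
        using bounds[of j] by (intro mult_left_mono) auto
      also have "\<dots> \<le> (?u j - ?l j) * max 0 (?h j - \<zeta>)"
        using bounds[of j] by (intro mult_right_mono) auto
      finally show "(p $ j - ?l j) * (?h j - \<zeta>) \<le> (?u j - ?l j) * max 0 (?h j - \<zeta>)" .
    qed
    finally show "(\<Sum>j\<in>UNIV. p $ j * ?h j) \<le> cut_value M N V s a \<zeta>"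
      unfolding cv by simp
  qed
qed

section \<open>Continuity of the Bellman update in the state\<close>

lemma continuous_cost_to_go:
  assumes "continuous_on (states M) V"
  shows "continuous_on (states M \<times> actions M) (\<lambda>(s, a). cost_to_go M V s a j)"
proof -
  have "continuous_on (states M \<times> actions M) (\<lambda>x. next_state M (fst x) (snd x) j)"
    unfolding next_state_def
    by (intro continuous_intros bounded_linear.continuous_on[OF matrix_vector_mul_bounded_linear])
  then have "continuous_on (states M \<times> actions M) (\<lambda>x. V (next_state M (fst x) (snd x) j))"
    by (rule continuous_on_compose2[OF assms]) (auto intro: next_state_in_states)
  then show ?thesis
    using continuous_cost[of j] unfolding cost_to_go_def case_prod_unfold
    by (intro continuous_intros)
qed

text \<open>Compactness of states times actions gives a modulus of continuity of the cost-to-go that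
  is uniform in the action, so it survives the infimum; finitely many scenarios allow a minimum of
  the moduli.\<close>

lemma bellman_uniformly_continuous:
  assumes "continuous_on (states M) V" and "0 < e"
  shows "\<exists>d>0. \<forall>s\<in>states M. \<forall>s'\<in>states M. norm (s' - s) < d \<longrightarrow> bellman M N V s \<le> bellman M N V s' + e"
proof -
  have "\<exists>d>0. \<forall>x\<in>states M \<times> actions M. \<forall>x'\<in>states M \<times> actions M.
      dist x' x < d \<longrightarrow> dist (case x' of (s, a) \<Rightarrow> cost_to_go M V s a j) (case x of (s, a) \<Rightarrow> cost_to_go M V s a j) < e" for j
    using compact_uniformly_continuous[OF continuous_cost_to_go[OF assms(1), of j]
        compact_Times[OF compact_states compact_actions]] \<open>0 < e\<close>
    unfolding uniformly_continuous_on_def by blast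
  then obtain d where d: "\<And>j. 0 < d j"
    and close: "\<And>j x x'. x \<in> states M \<times> actions M \<Longrightarrow> x' \<in> states M \<times> actions M \<Longrightarrow> dist x' x < d j \<Longrightarrow>
      dist (case x' of (s, a) \<Rightarrow> cost_to_go M V s a j) (case x of (s, a) \<Rightarrow> cost_to_go M V s a j) < e"
    by metis
  have "bdd V"
    using compact_continuous_image[OF assms(1) compact_states] by (rule compact_imp_bounded)
  have "bellman M N V s \<le> bellman M N V s' + e"
    if s: "s \<in> states M" "s' \<in> states M" and near: "norm (s' - s) < Min (range d)" for s s'
  proof (rule bellman_le[OF \<open>bdd V\<close> s])
    fix a j assume a: "a \<in> actions M"
    have "dist (s', a) (s, a) < d j"
      using near by (simp add: dist_Pair_Pair dist_norm)
    then show "cost_to_go M V s a j \<le> cost_to_go M V s' a j + e"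
      using close[of "(s, a)" "(s', a)" j] s a by (simp add: dist_real_def)
  qed
  moreover have "0 < Min (range d)" using d by simp
  ultimately show ?thesis by blast
qed

section \<open>Steps and runs of the cutting-plane algorithm\<close>

text \<open>The initial constant is the discounted cost of paying \<open>- cost_bound M\<close>
  forever, so it solves c = -C + \<gamma> c with C the cost bound. Being a subsolution, it starts
  the induction below \<open>Vstar\<close>.\<close>

lemma initial_le_bellman:
  assumes "s \<in> states M"
  shows "- cost_bound M / (1 - \<gamma>) \<le> bellman M N (\<lambda>_. - cost_bound M / (1 - \<gamma>)) s"
proof -
  define c where "c = - cost_bound M / (1 - \<gamma>)"
  have c: "c = - cost_bound M + \<gamma> * c"
    using discount by (simp add: c_def field_simps)
  have "c \<le> worst_case P (cost_to_go M (\<lambda>_. c) s a)" if a: "a \<in> actions M" for a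
  proof -
    have "c \<le> cost_to_go M (\<lambda>_. c) s a j + 0" for j
      using cost_bound[OF assms a, of j] c unfolding cost_to_go_def by linarith
    from worst_case_ambiguity_le[OF this] show ?thesis
      by (simp add: worst_case_const[OF ambiguity_subset ambiguity_nonempty])
  qed
  then show ?thesis
    unfolding bellman_eq[OF assms] c_def[symmetric] by (intro cINF_greatest[OF actions_nonempty])
qed

text \<open>The lower bound at the trial state is weak duality: there the cut takes the value
  \<open>cut_value\<close>, which dominates the worst case of the chosen action and hence the
  infimum over actions.\<close>

lemma bocp_step_properties:
  assumes "bocp_step M N i s V s' V'" and "s \<in> states M"
  shows "s' \<in> states M" and "V t \<le> V' t"
    and "bdd V \<Longrightarrow> bellman M N V s \<le> V' s"
    and "t \<in> states M \<Longrightarrow> V' t \<le> max (V t) (bellman M N V t)"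
    and "continuous_on (states M) V \<Longrightarrow> continuous_on (states M) V'"
proof -
  from assms(1) obtain a \<zeta> y q where a: "a \<in> actions M"
    and supporting: "\<And>t. t \<in> states M \<Longrightarrow> cut (cut_value M N V s a \<zeta>) q s t \<le> bellman M N V t"
    and V': "V' = (\<lambda>t. max (V t) (cut (cut_value M N V s a \<zeta>) q s t))"
    and s': "s' = next_state M s a i"
    unfolding bocp_step_def minimizer_def feasible_def by blast
  show "s' \<in> states M" unfolding s' using assms(2) a by (rule next_state_in_states)
  show "V t \<le> V' t" unfolding V' by simp
  show "t \<in> states M \<Longrightarrow> V' t \<le> max (V t) (bellman M N V t)"
    unfolding V' using supporting[of t] by simp
  show "bellman M N V s \<le> V' s" if "bdd V"
    using bellman_le_worst_case[OF that assms(2) a] worst_case_le_cut_value[of V s a \<zeta>]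
    by (simp add: V' cut_def)
  show "continuous_on (states M) V'" if "continuous_on (states M) V"
    unfolding V' cut_def using that by (intro continuous_intros)
qed

text \<open>A pathwise statement: \<open>d\<close> is one realization of the draws.\<close>

theorem bocp_run_converges:
  assumes fixed: "bounded_fixed_point M N Vstar"
    and run: "bocp_run M N s0 d sb V" and "s0 \<in> states M"
    and dense: "\<And>s e K. s \<in> states M \<Longrightarrow> 0 < e \<Longrightarrow> \<exists>k\<ge>K. norm (sb k - s) < e"
    and cont_lim: "continuous_on (states M) (\<lambda>s. lim (\<lambda>k. V k s))"
  shows "(\<forall>s\<in>states M. incseq (\<lambda>k. V k s) \<and> (\<lambda>k. V k s) \<longlonglongrightarrow> Vstar s)"
    and "(\<lambda>k. sup_norm_on (states M) (\<lambda>s. V k s - Vstar s)) \<longlonglongrightarrow> 0"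
proof -
  have V0: "V 0 = (\<lambda>_. - cost_bound M / (1 - \<gamma>))"
    and step: "\<And>k. bocp_step M N (d k) (sb k) (V k) (sb (Suc k)) (V (Suc k))"
    using run by (auto simp: bocp_run_def)
  have bdd_star: "bdd Vstar" and star: "\<And>s. s \<in> states M \<Longrightarrow> bellman M N Vstar s = Vstar s"
    using fixed by (auto simp: bounded_fixed_point_def)
  have sb: "sb k \<in> states M" for k
  proof (induction k)
    case 0
    then show ?case using run \<open>s0 \<in> states M\<close> by (simp add: bocp_run_def)
  next
    case (Suc k)
    then show ?case by (rule bocp_step_properties(1)[OF step])
  qed
  have mono: "incseq (\<lambda>k. V k s)" for s
    by (rule incseq_SucI) (rule bocp_step_properties(2)[OF step sb])
  \<comment> \<open>Each iterate is a maximum of a constant and finitely many affine cuts; Dini's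
    theorem needs this continuity.\<close>
  have cont: "continuous_on (states M) (V k)" for k
    by (induction k) (auto simp: V0 intro: bocp_step_properties(5)[OF step sb])
  have bdd: "bdd (V k)" for k
    using compact_continuous_image[OF cont compact_states] by (rule compact_imp_bounded)
  have below: "V k s \<le> Vstar s" if "s \<in> states M" for k s
    using that
  proof (induction k arbitrary: s)
    case 0
    show ?case
      unfolding V0
      by (rule bellman_comparison[OF _ bdd_star initial_le_bellman _ 0]) (auto simp: star image_constant_conv)
  next
    case (Suc k)
    have "bellman M N (V k) s \<le> Vstar s"
      using bellman_shift[OF bdd Suc.prems, of k Vstar 0] Suc.IH star[OF Suc.prems] by simp
    then show ?case
      using bocp_step_properties(4)[OF step sb Suc.prems, of k] Suc.IH[OF Suc.prems] by simp
  qed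
  define W where "W = (\<lambda>s. lim (\<lambda>k. V k s))"
  \<comment> \<open>\<open>lim\<close> is meaningful only for convergent sequences; monotonicity and
    the bound \<open>Vstar\<close> supply convergence on the states.\<close>
  have lim: "(\<lambda>k. V k s) \<longlonglongrightarrow> W s" if "s \<in> states M" for s
  proof -
    have "convergent (\<lambda>k. V k s)"
      using incseq_convergent[OF mono[of s], of "Vstar s"] below[OF that]
      by (meson convergentI)
    then show ?thesis unfolding W_def by (simp add: convergent_LIMSEQ_iff)
  qed
  have V_le_W: "V k s \<le> W s" if "s \<in> states M" for k s
    using incseq_le[OF mono lim[OF that]] .
  have cont_W: "continuous_on (states M) W"
    using cont_lim by (simp add: W_def)
  have bdd_W: "bdd W"
    using compact_continuous_image[OF cont_W compact_states] by (rule compact_imp_bounded)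
  have unif: "\<exists>n. \<forall>m\<ge>n. \<forall>x\<in>states M. W x - V m x < e" if "0 < e" for e
    by (rule Dini_mono[OF compact_states cont cont_W mono lim that])
  have super: "bellman M N W s \<le> W s" if s: "s \<in> states M" for s
  proof (rule field_le_epsilon)
    fix e :: real assume "0 < e"
    \<comment> \<open>One third each for the continuity of the Bellman update of \<open>W\<close>,
      the uniform distance of \<open>V k\<close> from \<open>W\<close>, and the continuity of
      \<open>W\<close> at \<open>s\<close>.\<close>
    then have e3: "0 < e / 3" by simp
    obtain n where n: "\<And>m x. n \<le> m \<Longrightarrow> x \<in> states M \<Longrightarrow> W x - V m x < e / 3"
      using unif[OF e3] by blast
    obtain d1 where d1: "0 < d1" "\<And>t. t \<in> states M \<Longrightarrow> norm (t - s) < d1 \<Longrightarrow> bellman M N W s \<le> bellman M N W t + e / 3"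
      using bellman_uniformly_continuous[OF cont_W e3] s by blast
    obtain d2 where d2: "0 < d2" "\<And>t. t \<in> states M \<Longrightarrow> dist t s < d2 \<Longrightarrow> dist (W t) (W s) < e / 3"
      using cont_W s e3 unfolding continuous_on_iff by blast
    \<comment> \<open>The visit must be both near \<open>s\<close> and late enough for the uniform
      approximation, hence the need for arbitrarily late visits.\<close>
    obtain k where k: "n \<le> k" "norm (sb k - s) < min d1 d2"
      using dense[OF s, of "min d1 d2" n] d1(1) d2(1) by auto
    have "bellman M N W s \<le> bellman M N W (sb k) + e / 3"
      using d1(2)[OF sb[of k]] k(2) by simp
    also have "bellman M N W (sb k) \<le> bellman M N (V k) (sb k) + \<gamma> * (e / 3)"
    proof (rule bellman_shift[OF bdd_W sb])
      fix t assume "t \<in> states M"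
      then show "W t \<le> V k t + e / 3" using n[OF k(1), of t] by linarith
    qed
    also have "\<gamma> * (e / 3) \<le> e / 3"
      using discount e3 by (intro mult_left_le_one_le) auto
    \<comment> \<open>The cut made at \<open>sb k\<close> from \<open>V k\<close> enters the next
      iterate, hence \<open>Suc k\<close>.\<close>
    also have "bellman M N (V k) (sb k) \<le> V (Suc k) (sb k)"
      by (rule bocp_step_properties(3)[OF step sb bdd])
    also have "V (Suc k) (sb k) \<le> W (sb k)"
      by (rule V_le_W[OF sb])
    also have "W (sb k) \<le> W s + e / 3"
    proof -
      have "dist (W (sb k)) (W s) < e / 3"
        using d2(2)[OF sb[of k]] k(2) by (simp add: dist_norm)
      then show ?thesis unfolding dist_real_def by linarith
    qed
    finally show "bellman M N W s \<le> W s + e" by simp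
  qed
  have W_eq: "W s = Vstar s" if s: "s \<in> states M" for s
  proof (rule antisym)
    show "W s \<le> Vstar s"
      using lim[OF s] below[OF s] by (intro LIMSEQ_le_const2) auto
    show "Vstar s \<le> W s"
      using star super by (intro bellman_comparison[OF bdd_star bdd_W _ _ s]) auto
  qed
  show "(\<forall>s\<in>states M. incseq (\<lambda>k. V k s) \<and> (\<lambda>k. V k s) \<longlonglongrightarrow> Vstar s)"
    using mono lim W_eq by auto
  show "(\<lambda>k. sup_norm_on (states M) (\<lambda>s. V k s - Vstar s)) \<longlonglongrightarrow> 0"
    using unif W_eq by (intro sup_norm_on_diff_tendsto_0[OF states_nonempty below]) auto
qed

end

section \<open>Almost sure convergence of the random algorithm\<close>

theorem theorem8:
  fixes M :: "('m::finite, 'n::finite, 'k::finite, 'j::finite) dro_problem"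
    and N :: nat
    and Vstar :: "real ^ 'm \<Rightarrow> real"
    and \<Omega> :: "'w measure"
    and draw :: "nat \<Rightarrow> 'w \<Rightarrow> 'j"
    and s0 :: "real ^ 'm"
    and sbar :: "nat \<Rightarrow> 'w \<Rightarrow> real ^ 'm"
    and V :: "nat \<Rightarrow> 'w \<Rightarrow> real ^ 'm \<Rightarrow> real"
  assumes "states M \<noteq> {}" and "actions M \<noteq> {}"
    and "inj (scenario M)"
    and "\<forall>s\<in>states M. \<forall>a\<in>actions M. \<forall>\<xi>\<in>scenarios M. dynamics M s a \<xi> \<in> states M"
    and "0 \<le> discount M" and "discount M < 1"
    and "bdd_above ((\<lambda>(s, a, \<xi>). \<bar>cost M s a \<xi>\<bar>) ` (states M \<times> actions M \<times> scenarios M))"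
    and "\<forall>j. 1 < prior M j"
    and "\<forall>i\<in>{1..N}. obs M i \<in> scenarios M"
    and "0 < level M" and "level M < 1"
    and "0 < lower_mass M N" and "lower_mass M N < 1" and "1 < upper_mass M N"
    and "convex (states M)" and "compact (states M)"
    and "convex (actions M)" and "compact (actions M)"
    and "\<forall>\<xi>\<in>scenarios M. convex_on (states M \<times> actions M) (\<lambda>(s, a). cost M s a \<xi>)"
    and "\<forall>\<xi>\<in>scenarios M. continuous_on (states M \<times> actions M) (\<lambda>(s, a). cost M s a \<xi>)"
    and "\<forall>s\<in>states M. \<forall>a\<in>actions M. \<forall>\<xi>\<in>scenarios M.
           dynamics M s a \<xi> = matA M \<xi> *v s + matB M \<xi> *v a + vecb M \<xi>"
    and "matA M \<in> borel_measurable (restrict_space borel (scenarios M))"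
    and "matB M \<in> borel_measurable (restrict_space borel (scenarios M))"
    and "vecb M \<in> borel_measurable (restrict_space borel (scenarios M))"
    and "bounded_fixed_point M N Vstar"
    and "prob_space \<Omega>"
    and "\<forall>k. draw k \<in> measurable \<Omega> (count_space UNIV)"
    and "s0 \<in> states M"
    and "AE \<omega> in \<Omega>. bocp_run M N s0 (\<lambda>k. draw k \<omega>) (\<lambda>k. sbar k \<omega>) (\<lambda>k. V k \<omega>)"
    and "\<forall>s\<in>states M. \<forall>\<epsilon>>0. \<forall>K. AE \<omega> in \<Omega>. \<exists>k\<ge>K. norm (sbar k \<omega> - s) < \<epsilon>"
    and "AE \<omega> in \<Omega>. continuous_on (states M) (\<lambda>s. lim (\<lambda>k. V k \<omega> s))"
  shows "AE \<omega> in \<Omega>.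
           (\<forall>s\<in>states M. incseq (\<lambda>k. V k \<omega> s) \<and> (\<lambda>k. V k \<omega> s) \<longlonglongrightarrow> Vstar s) \<and>
           (\<lambda>k. sup_norm_on (states M) (\<lambda>s. V k \<omega> s - Vstar s)) \<longlonglongrightarrow> 0"
proof -
  interpret dro M N
    using assms(1,2,4-8,12-14,16,18,20,21) by unfold_locales (auto simp: next_state_def)
  \<comment> \<open>A single null set now serves all states, radii and start indices, so the
    pathwise theorem applies to almost every \<omega>.\<close>
  from assms(30) have "AE \<omega> in \<Omega>. \<forall>s\<in>states M. \<forall>\<epsilon>>0. \<forall>K. \<exists>k\<ge>K. norm (sbar k \<omega> - s) < \<epsilon>"
    by (intro AE_dense_visits) blast
  with assms(29,31) show ?thesis
  proof eventually_elim
    case (elim \<omega>)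
    from bocp_run_converges[OF assms(25) elim(1) assms(28) _ elim(2)] elim(3) show ?case by blast
  qed
qed

end
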